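(* Let $n\ge 1$ and let $\alpha\in\mathcal{OCT}_n$ be written as $\alpha=\begin{pmatrix}A_1&A_2&\cdots&A_p\\ x_1&x_2&\cdots&x_p\end{pmatrix}$ with $\mathbf{Ker}\,\alpha=\{A_1<A_2<\cdots<A_p\}$. Then $\alpha$ is regular in $\mathcal{OCT}_n$ if and only if there is an integer $d$ such that $\min A_p-x_p=\max A_1-x_1=d$ and $A_i=\{x_i+d\}$ for $i=2,\ldots,p-1$.
   Context: $[n]=\{1,\ldots,n\}$. $\mathcal{OCT}_n$ is the semigroup, under composition, of all maps $\alpha:[n]\to[n]$ (written on the right) that are contractions ($|x\alpha-y\alpha|\le|x-y|$ for all $x,y$) and order preserving ($x\le y$ implies $x\alpha\le y\alpha$). $\mathbf{Ker}\,\alpha$ is the partition of $[n]$ into the classes of $\{(x,y):x\alpha=y\alpha\}$; the two-row notation means that the blocks are $A_1,\ldots,A_p$ and $A_i=x_i\alpha^{-1}$. $A<B$ means $a<b$ for all $a\in A$, $b\in B$. An element $a$ of a semigroup $S$ is regular if $a=aba$ for some $b\in S$.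
   Formalization: The formal theorem assumes p ≥ 2 or n = 1, excluding constant maps for n ≥ 2: these are idempotent, hence regular, but have A_1 = [n], so min A_p − x_p ≠ max A_1 − x_1 and the stated equivalence fails for them. *)

theory Defs
  imports "HOL-Algebra.Group"
begin

definition contraction_on :: "int set \<Rightarrow> (int \<Rightarrow> int) \<Rightarrow> bool" where
  "contraction_on X f \<longleftrightarrow> (\<forall>x\<in>X. \<forall>y\<in>X. \<bar>f x - f y\<bar> \<le> \<bar>x - y\<bar>)"

text \<open>
  Points of $[n]$ are integers, so that differences of points are not truncated. Maps
  $[n] \to [n]$ are extensional functions, so that equality of elements is equality of maps.
  Maps act on the right: the product of \<open>\<alpha>\<close> and \<open>\<beta>\<close> applies \<open>\<alpha>\<close> first. The
  identity map belongs to the semigroup, so the library's monoid record is used.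
\<close>

definition OCT :: "nat \<Rightarrow> (int \<Rightarrow> int) monoid" where
  "OCT n = \<lparr>carrier = {\<alpha> \<in> {1..int n} \<rightarrow>\<^sub>E {1..int n}.
                        contraction_on {1..int n} \<alpha> \<and> mono_on {1..int n} \<alpha>},
            monoid.mult = (\<lambda>\<alpha> \<beta>. compose {1..int n} \<beta> \<alpha>),
            one = (\<lambda>x\<in>{1..int n}. x)\<rparr>"

lemma monoid_OCT: "monoid (OCT n)"
proof (rule monoidI)
  fix \<alpha> \<beta>
  assume "\<alpha> \<in> carrier (OCT n)" "\<beta> \<in> carrier (OCT n)"
  then have a: "\<alpha> \<in> {1..int n} \<rightarrow>\<^sub>E {1..int n}" "contraction_on {1..int n} \<alpha>" "mono_on {1..int n} \<alpha>"
    and b: "\<beta> \<in> {1..int n} \<rightarrow>\<^sub>E {1..int n}" "contraction_on {1..int n} \<beta>" "mono_on {1..int n} \<beta>"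
    by (simp_all add: OCT_def)
  have m: "\<alpha> x \<in> {1..int n}" if "x \<in> {1..int n}" for x
    using a(1) that by (rule PiE_mem)
  have "compose {1..int n} \<beta> \<alpha> \<in> {1..int n} \<rightarrow>\<^sub>E {1..int n}"
    using PiE_mem[OF b(1)] m by (auto simp: compose_def simp del: atLeastAtMost_iff)
  moreover have "contraction_on {1..int n} (compose {1..int n} \<beta> \<alpha>)"
    unfolding contraction_on_def
  proof (intro ballI)
    fix x y assume xy: "x \<in> {1..int n}" "y \<in> {1..int n}"
    have "\<bar>\<beta> (\<alpha> x) - \<beta> (\<alpha> y)\<bar> \<le> \<bar>\<alpha> x - \<alpha> y\<bar>"
      using b(2) m xy by (simp add: contraction_on_def del: atLeastAtMost_iff)
    also have "\<dots> \<le> \<bar>x - y\<bar>"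
      using a(2) xy by (simp add: contraction_on_def del: atLeastAtMost_iff)
    finally show "\<bar>compose {1..int n} \<beta> \<alpha> x - compose {1..int n} \<beta> \<alpha> y\<bar> \<le> \<bar>x - y\<bar>"
      using xy by (simp add: compose_def)
  qed
  moreover have "mono_on {1..int n} (compose {1..int n} \<beta> \<alpha>)"
  proof (rule mono_onI)
    fix x y assume xy: "x \<in> {1..int n}" "y \<in> {1..int n}" "x \<le> y"
    then have "\<beta> (\<alpha> x) \<le> \<beta> (\<alpha> y)"
      using m by (intro mono_onD[OF b(3)] mono_onD[OF a(3)])
    then show "compose {1..int n} \<beta> \<alpha> x \<le> compose {1..int n} \<beta> \<alpha> y"
      using xy by (simp add: compose_def)
  qed
  ultimately show "\<alpha> \<otimes>\<^bsub>OCT n\<^esub> \<beta> \<in> carrier (OCT n)"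
    by (simp add: OCT_def)
next
  show "\<one>\<^bsub>OCT n\<^esub> \<in> carrier (OCT n)"
    by (auto simp: OCT_def contraction_on_def intro!: mono_onI)
next
  fix \<alpha> \<beta> \<gamma>
  assume "\<alpha> \<in> carrier (OCT n)" "\<beta> \<in> carrier (OCT n)" "\<gamma> \<in> carrier (OCT n)"
  then show "\<alpha> \<otimes>\<^bsub>OCT n\<^esub> \<beta> \<otimes>\<^bsub>OCT n\<^esub> \<gamma> = \<alpha> \<otimes>\<^bsub>OCT n\<^esub> (\<beta> \<otimes>\<^bsub>OCT n\<^esub> \<gamma>)"
    by (auto simp: OCT_def intro!: compose_assoc)
next
  fix \<alpha>
  assume "\<alpha> \<in> carrier (OCT n)"
  then have "\<alpha> \<in> {1..int n} \<rightarrow>\<^sub>E {1..int n}" by (simp add: OCT_def)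
  then show "\<one>\<^bsub>OCT n\<^esub> \<otimes>\<^bsub>OCT n\<^esub> \<alpha> = \<alpha>" "\<alpha> \<otimes>\<^bsub>OCT n\<^esub> \<one>\<^bsub>OCT n\<^esub> = \<alpha>"
    unfolding OCT_def by (auto intro!: compose_Id Id_compose simp: PiE_iff)
qed

definition regular_element :: "('a, 'b) monoid_scheme \<Rightarrow> 'a \<Rightarrow> bool" where
  "regular_element S a \<longleftrightarrow>
     a \<in> carrier S \<and> (\<exists>b\<in>carrier S. a = a \<otimes>\<^bsub>S\<^esub> b \<otimes>\<^bsub>S\<^esub> a)"

definition Ker_partition :: "nat \<Rightarrow> (int \<Rightarrow> int) \<Rightarrow> int set set" where
  "Ker_partition n \<alpha> =
     {1..int n} // {(x, y). x \<in> {1..int n} \<and> y \<in> {1..int n} \<and> \<alpha> x = \<alpha> y}"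

end

theory Submission
  imports Defs
begin

text \<open>
  If \<open>\<alpha> = \<alpha>\<beta>\<alpha>\<close>, then \<open>\<beta>\<close> sends $x_i$ into $A_i$. As both maps are contractions, the chain
  $\min A_p - \max A_1 \le x_p\beta - x_1\beta \le x_p - x_1 \le \min A_p - \max A_1$ collapses, so
  \<open>\<alpha>\<close> attains the maximal slope between $\max A_1$ and $\min A_p$ and hence is a translation there.
  Conversely, truncating to $[x_1, x_p]$ and then translating by $d$ is an inverse of \<open>\<alpha>\<close>.
\<close>

lemma OCT_carrierD:
  assumes "\<alpha> \<in> carrier (OCT n)"
  shows OCT_range: "z \<in> {1..int n} \<Longrightarrow> \<alpha> z \<in> {1..int n}"
    and OCT_contraction: "y \<in> {1..int n} \<Longrightarrow> z \<in> {1..int n} \<Longrightarrow> \<bar>\<alpha> y - \<alpha> z\<bar> \<le> \<bar>y - z\<bar>"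
    and OCT_mono: "y \<in> {1..int n} \<Longrightarrow> z \<in> {1..int n} \<Longrightarrow> y \<le> z \<Longrightarrow> \<alpha> y \<le> \<alpha> z"
    and OCT_extensional: "\<alpha> \<in> extensional {1..int n}"
  using assms unfolding OCT_def contraction_on_def PiE_def Pi_def by (auto intro: mono_onD)

text \<open>Both sides of \<open>\<alpha> = \<alpha>\<beta>\<alpha>\<close> are extensional on [n],
  so the equation can be tested pointwise there. This removes \<open>compose\<close> and
  \<open>restrict\<close> from the main argument.\<close>

lemma regular_OCT_iff:
  assumes \<alpha>: "\<alpha> \<in> carrier (OCT n)"
  shows "regular_element (OCT n) \<alpha> \<longleftrightarrow>
    (\<exists>\<beta>\<in>carrier (OCT n). \<forall>z\<in>{1..int n}. \<alpha> (\<beta> (\<alpha> z)) = \<alpha> z)"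
proof -
  have "\<alpha> = \<alpha> \<otimes>\<^bsub>OCT n\<^esub> \<beta> \<otimes>\<^bsub>OCT n\<^esub> \<alpha> \<longleftrightarrow> (\<forall>z\<in>{1..int n}. \<alpha> (\<beta> (\<alpha> z)) = \<alpha> z)" for \<beta>
  proof -
    have "\<alpha> \<otimes>\<^bsub>OCT n\<^esub> \<beta> \<otimes>\<^bsub>OCT n\<^esub> \<alpha> = (\<lambda>z\<in>{1..int n}. \<alpha> (\<beta> (\<alpha> z)))"
      by (auto simp: OCT_def compose_def restrict_def)
    moreover have "\<alpha> = (\<lambda>z\<in>{1..int n}. \<alpha> z)"
      using OCT_extensional[OF \<alpha>] by (simp add: extensional_restrict)
    ultimately show ?thesis
      by (metis (no_types, lifting) restrict_apply' restrict_ext)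
  qed
  then show ?thesis
    using \<alpha> by (simp add: regular_element_def)
qed

text \<open>Clamping to [u, v] and translating by d are each monotone and 1-Lipschitz. The image
  lies in [u + d, v + d], which the last two assumptions place inside [n]; u and v themselves may
  lie outside [n].\<close>

lemma truncated_translation_in_OCT:
  fixes u v d :: int
  assumes "u \<le> v" "1 \<le> u + d" "v + d \<le> int n"
  shows "(\<lambda>y\<in>{1..int n}. max u (min v y) + d) \<in> carrier (OCT n)"
  using assms by (auto simp: OCT_def contraction_on_def intro!: mono_onI)

lemma Ker_partition_Union: "\<Union> (Ker_partition n \<alpha>) = {1..int n}"
  unfolding Ker_partition_def by (intro Union_quotient equivI refl_onI symI transI) auto

lemma Ker_partition_nonempty: "{} \<notin> Ker_partition n \<alpha>"
  unfolding Ker_partition_def by (auto simp: quotient_def)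

theorem corollary1p16:
  fixes n p :: nat and \<alpha> :: "int \<Rightarrow> int" and A :: "nat \<Rightarrow> int set" and x :: "nat \<Rightarrow> int"
  assumes "n \<ge> 1"
    and "\<alpha> \<in> carrier (OCT n)"
    and "Ker_partition n \<alpha> = A ` {1..p}"
    and "\<And>i j a b. \<lbrakk>1 \<le> i; i < j; j \<le> p; a \<in> A i; b \<in> A j\<rbrakk> \<Longrightarrow> a < b"
    and "\<And>i. i \<in> {1..p} \<Longrightarrow> A i = \<alpha> -` {x i} \<inter> {1..int n}"
    and "p \<ge> 2 \<or> n = 1"
  shows "regular_element (OCT n) \<alpha> \<longleftrightarrow>
    (\<exists>d::int. Min (A p) - x p = d \<and> Max (A 1) - x 1 = d \<and> (\<forall>i\<in>{2..p-1}. A i = {x i + d}))"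
proof -
  note \<alpha> = assms(2)
  note less = assms(4)
  have cover: "\<exists>i\<in>{1..p}. z \<in> A i" if "z \<in> {1..int n}" for z
    using Ker_partition_Union[of n \<alpha>] that assms(3) by auto
  have ne: "A i \<noteq> {}" if "i \<in> {1..p}" for i
    using Ker_partition_nonempty[of n \<alpha>] that assms(3) by (metis imageI)
  have memD: "a \<in> {1..int n}" "\<alpha> a = x i" if "i \<in> {1..p}" "a \<in> A i" for i a
    using assms(5)[OF that(1)] that(2) by auto
  have memI: "a \<in> A i" if "i \<in> {1..p}" "a \<in> {1..int n}" "\<alpha> a = x i" for i a
    using assms(5)[OF that(1)] that by auto
  have fin: "finite (A i)" if "i \<in> {1..p}" for i
    using assms(5)[OF that] by simp
  have "p \<ge> 1"
    using cover[of 1] assms(1) by auto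
  then have ends: "1 \<in> {1..p}" "p \<in> {1..p}"
    by auto
  define M m where "M = Max (A 1)" and "m = Min (A p)"
  have M: "M \<in> A 1" and m: "m \<in> A p"
    unfolding M_def m_def using ends fin ne by (auto intro!: Max_in Min_in)
  note Mn = memD[OF ends(1) M] and mn = memD[OF ends(2) m]
  have x_mono: "x i \<le> x j" if "1 \<le> i" "i \<le> j" "j \<le> p" for i j
  proof (cases "i = j")
    case False
    have ij: "i \<in> {1..p}" "j \<in> {1..p}"
      using that by auto
    obtain a b where ab: "a \<in> A i" "b \<in> A j"
      using ne[OF ij(1)] ne[OF ij(2)] by auto
    have "a \<le> b"
      using less[OF that(1) _ that(3) ab] that False by simp
    then show ?thesis
      using OCT_mono[OF \<alpha>] memD[OF ij(1) ab(1)] memD[OF ij(2) ab(2)] by metis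
  qed simp
  have x_image: "x i \<in> {1..int n}" if "i \<in> {1..p}" for i
    using ne[OF that] memD[OF that] OCT_range[OF \<alpha>] by (metis ex_in_conv)
  \<comment> \<open>If p = 1, the only block is [n], so M = n and m = 1, and the inequality needs n
    = 1. Constant maps with n \<ge> 2 are regular, yet \<open>Min (A p) - x p\<close> and
    \<open>Max (A 1) - x 1\<close> differ for them; \<open>p \<ge> 2 \<or> n = 1\<close> excludes
    this case.\<close>
  have M_le_m: "M \<le> m"
  proof (cases "p \<ge> 2")
    case True
    then show ?thesis
      using less[of 1 p M m] M m by simp
  next
    case False
    then show ?thesis
      using Mn(1) mn(1) assms(6) by simp
  qed
  show ?thesis
  proof
    assume "regular_element (OCT n) \<alpha>"
    then obtain \<beta> where \<beta>: "\<beta> \<in> carrier (OCT n)"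
      and inv: "\<And>z. z \<in> {1..int n} \<Longrightarrow> \<alpha> (\<beta> (\<alpha> z)) = \<alpha> z"
      using regular_OCT_iff[OF \<alpha>] by blast
    \<comment> \<open>At any a in \<open>A i\<close>, \<open>inv\<close> reads \<alpha> (\<beta> (x
      i)) = x i.\<close>
    have \<beta>_mem: "\<beta> (x i) \<in> A i" if i: "i \<in> {1..p}" for i
    proof -
      obtain a where "a \<in> A i"
        using ne[OF i] by auto
      then show ?thesis
        using memD[OF i] inv OCT_range[OF \<beta>] x_image[OF i] by (metis memI[OF i])
    qed
    have "\<beta> (x 1) \<le> M"
      unfolding M_def using \<beta>_mem fin ends(1) by simp
    moreover have "m \<le> \<beta> (x p)"
      unfolding m_def using \<beta>_mem fin ends(2) by simp
    moreover have "\<bar>\<beta> (x p) - \<beta> (x 1)\<bar> \<le> \<bar>x p - x 1\<bar>"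
      using OCT_contraction[OF \<beta>] x_image ends by blast
    moreover have "\<bar>x p - x 1\<bar> \<le> \<bar>m - M\<bar>"
      using OCT_contraction[OF \<alpha> mn(1) Mn(1)] Mn mn by simp
    \<comment> \<open>Together with \<open>M_le_m\<close> this removes the absolute values, and the
      preceding bounds force m - M = x p - x 1.\<close>
    moreover have "x 1 \<le> x p"
      using x_mono \<open>p \<ge> 1\<close> by simp
    ultimately have d: "m - x p = M - x 1"
      using M_le_m by linarith
    have "A i = {x i + (M - x 1)}" if i: "i \<in> {2..p-1}" for i
    proof -
      have ip: "i \<in> {1..p}"
        using i by auto
      have "a = x i + (M - x 1)" if a: "a \<in> A i" for a
      proof -
        have "M < a" "a < m"
          using less[of 1 i M a] less[of i p a m] i M m a by auto
        \<comment> \<open>A squeeze: the bound from M gives \<alpha> a \<le> x 1 + (a - M), the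
          bound from m gives \<alpha> a \<ge> x p - (m - a), and by \<open>d\<close> the two
          right-hand sides agree.\<close>
        moreover have "\<bar>\<alpha> a - \<alpha> M\<bar> \<le> \<bar>a - M\<bar>" "\<bar>\<alpha> m - \<alpha> a\<bar> \<le> \<bar>m - a\<bar>"
          using OCT_contraction[OF \<alpha>] memD(1)[OF ip a] Mn(1) mn(1) by blast+
        ultimately show ?thesis
          using memD(2)[OF ip a] Mn(2) mn(2) d by linarith
      qed
      then show ?thesis
        using ne[OF ip] by blast
    qed
    then show "\<exists>d. Min (A p) - x p = d \<and> Max (A 1) - x 1 = d \<and> (\<forall>i\<in>{2..p-1}. A i = {x i + d})"
      using d by (simp add: M_def m_def)
  next
    assume "\<exists>d. Min (A p) - x p = d \<and> Max (A 1) - x 1 = d \<and> (\<forall>i\<in>{2..p-1}. A i = {x i + d})"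
    then obtain d where d: "m = x p + d" "M = x 1 + d"
      and mid: "\<And>i. i \<in> {2..p-1} \<Longrightarrow> A i = {x i + d}"
      unfolding M_def m_def by (metis add.commute diff_add_cancel)
    \<comment> \<open>Translation by d alone could leave [n]. Since x 1 + d = M and x p + d = m,
      clamping first confines all values to [M, m].\<close>
    let ?\<beta> = "\<lambda>y\<in>{1..int n}. max (x 1) (min (x p) y) + d"
    have "?\<beta> \<in> carrier (OCT n)"
      using x_mono \<open>p \<ge> 1\<close> Mn(1) mn(1) d by (intro truncated_translation_in_OCT) auto
    moreover have "\<alpha> (?\<beta> (\<alpha> z)) = \<alpha> z" if zn: "z \<in> {1..int n}" for z
    proof -
      obtain i where i: "i \<in> {1..p}" and z: "z \<in> A i"
        using cover[OF zn] by blast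
      \<comment> \<open>It suffices that the inverse picks one point of each block: M from the
        first, m from the last, and the only point of each middle block. For p \<le> 2 there are no
        middle blocks.\<close>
      have "x i + d \<in> A i"
      proof -
        consider "i = 1" | "i = p" | "i \<in> {2..p-1}"
          using i by fastforce
        then show ?thesis
          using M m d mid by cases auto
      qed
      moreover have "?\<beta> (x i) = x i + d"
        using x_image[OF i] x_mono[of 1 i] x_mono[of i p] i by simp
      ultimately show ?thesis
        using memD(2)[OF i] z by metis
    qed
    ultimately show "regular_element (OCT n) \<alpha>"
      using regular_OCT_iff[OF \<alpha>] by blast
  qed
qed

end
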